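(* For every positive integer $n$, the set $\mathscr{C}_{F_{2k-1}}(n)$ of compositions of $n$ in which each part equal to $k$ comes in $F_{2k-1}$ colors is in one-to-one correspondence with the set of unimodal sequences of length $n$ covering an initial interval of positive integers. These sets are enumerated by the sequence $1,3,10,34,116,396,1352,4616,\dots$, i.e. their common cardinality $b_n$ satisfies $b_1=1$, $b_2=3$, $b_n=4b_{n-1}-2b_{n-2}$ for $n\ge3$.
   Context: $F_0=0$, $F_1=1$, $F_n=F_{n-1}+F_{n-2}$ are the Fibonacci numbers. A $w$-colored composition of $n$ (for a sequence $(w_k)$ of nonnegative integers) is a composition $(j_1,\dots,j_m)$ of $n$ together with a choice of one of $w_{j_i}$ colors for each part $j_i$; $\mathscr{C}_{w_k}(n)$ is the set of these. A sequence $(a_1,\dots,a_n)$ of positive integers is unimodal if there is an index $t$ with $a_1\le\dots\le a_t\ge a_{t+1}\ge\dots\ge a_n$; it covers an initial interval of positive integers if $\{a_1,\dots,a_n\}=\{1,2,\dots,m\}$ for some $m$. *)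

theory Defs
  imports "HOL-Number_Theory.Fib"
begin

text \<open>
  A \<open>w\<close>-colored composition is a list of pairs (part, color); the \<open>w k\<close> colors
  available to a part \<open>k\<close> are \<open>0, \<dots>, w k - 1\<close>.
\<close>

definition colored_compositions :: "(nat \<Rightarrow> nat) \<Rightarrow> nat \<Rightarrow> (nat \<times> nat) list set" where
  "colored_compositions w n =
     {xs. (\<forall>(k, c) \<in> set xs. 1 \<le> k \<and> c < w k) \<and> sum_list (map fst xs) = n}"

text \<open>The peak index \<open>t\<close> is 0-based and must be a position of the list, so \<open>[]\<close> is not unimodal.\<close>

definition unimodal :: "nat list \<Rightarrow> bool" where
  "unimodal xs \<longleftrightarrow>
     (\<exists>t < length xs. (\<forall>i < t. xs ! i \<le> xs ! Suc i) \<and>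
        (\<forall>i. t \<le> i \<and> Suc i < length xs \<longrightarrow> xs ! Suc i \<le> xs ! i))"

definition covers_initial_interval :: "nat list \<Rightarrow> bool" where
  "covers_initial_interval xs \<longleftrightarrow> (\<exists>m. set xs = {1..m})"

definition unimodal_covering :: "nat \<Rightarrow> nat list set" where
  "unimodal_covering n =
     {xs. length xs = n \<and> (\<forall>x \<in> set xs. 0 < x) \<and> unimodal xs \<and> covers_initial_interval xs}"

end

theory Submission
  imports Defs
begin

text \<open>
  Both cardinalities satisfy the recurrence \<open>b n = 4 * b (n - 1) - 2 * b (n - 2)\<close> for \<open>n \<ge> 3\<close>
  with the initial values 1 and 3.

  Splitting off the first part of a colored composition expresses the number of these as a
  convolution with \<open>fib (2 * k - 1)\<close>, and \<open>fib (2 * k + 3) = 3 * fib (2 * k + 1) - fib (2 * k - 1)\<close>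
  collapses the convolution.

  The minimum of a unimodal sequence is attained at one of its ends, so a covering unimodal
  sequence of length at least 2 begins or ends with 1. What remains after deleting one such 1 is
  either again covering, or is a covering sequence with all entries raised by one; this gives
  \<open>2 * b (n - 1)\<close> sequences that begin with 1, as many that end with 1, and, for \<open>n \<ge> 3\<close>,
  \<open>2 * b (n - 2)\<close> that do both.
\<close>

section \<open>Colored compositions\<close>

lemma colored_compositions_0: "colored_compositions w 0 = {[]}"
proof -
  have "xs = []" if "xs \<in> colored_compositions w 0" for xs
    using that by (cases xs) (auto simp: colored_compositions_def)
  then show ?thesis
    by (auto simp: colored_compositions_def)
qed

text \<open>Case distinction on the first part, written \<open>Suc i\<close> because parts are
  positive; the others sum to \<open>n - i\<close>, which is not truncated since
  \<open>i \<le> n\<close>.\<close>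

lemma colored_compositions_Suc:
  "colored_compositions w (Suc n) =
     (\<Union>i\<le>n. (\<lambda>(c, xs). (Suc i, c) # xs) ` ({..<w (Suc i)} \<times> colored_compositions w (n - i)))"
  (is "?L = ?R")
proof (intro set_eqI iffI)
  fix ys assume ys: "ys \<in> ?L"
  then obtain k c xs where "ys = (k, c) # xs"
    by (cases ys) (auto simp: colored_compositions_def)
  moreover from this ys obtain i where "k = Suc i"
    by (cases k) (auto simp: colored_compositions_def)
  ultimately have *: "ys = (Suc i, c) # xs" by simp
  then have "i \<le> n" "c < w (Suc i)" "xs \<in> colored_compositions w (n - i)"
    using ys by (auto simp: colored_compositions_def)
  then show "ys \<in> ?R"
    using * by force
next
  fix ys assume "ys \<in> ?R"
  then show "ys \<in> ?L"
    by (auto simp: colored_compositions_def)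
qed

lemma finite_colored_compositions: "finite (colored_compositions w n)"
proof (induction n rule: less_induct)
  case (less n)
  then show ?case
    by (cases n) (auto simp: colored_compositions_0 colored_compositions_Suc)
qed

lemma card_colored_compositions_Suc:
  "card (colored_compositions w (Suc n)) =
     (\<Sum>i\<le>n. w (Suc i) * card (colored_compositions w (n - i)))"
proof -
  have inj: "inj_on (\<lambda>(c, xs). (Suc i, c) # xs) A" for i and A :: "(nat \<times> (nat \<times> nat) list) set"
    by (auto simp: inj_on_def)
  show ?thesis
    unfolding colored_compositions_Suc
    by (subst card_UN_disjoint)
      (auto simp: card_image[OF inj] card_cartesian_product finite_colored_compositions)
qed

lemma fib_add_4: "fib (n + 4) + fib n = 3 * fib (n + 2)"
  by (simp add: numeral_eq_Suc)

text \<open>The generating function of \<open>fib (2 * i + 1)\<close> is (1 - x) / (1 - 3x + x^2);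
  this is convolution with it after clearing the denominator.\<close>

lemma fib_convolution_add_2:
  fixes c :: "nat \<Rightarrow> int"
  defines "s \<equiv> \<lambda>n. \<Sum>i\<le>n. int (fib (2 * i + 1)) * c (n - i)"
  shows "s (n + 2) = c (n + 2) - c (n + 1) + 3 * s (n + 1) - s n"
proof -
  have s_Suc: "s (n + 1) = c (n + 1) + (\<Sum>i\<le>n. int (fib (2 * i + 3)) * c (n - i))"
    unfolding s_def by (simp add: sum.atMost_Suc_shift numeral_3_eq_3 del: sum.atMost_Suc fib.simps(3))
  \<comment> \<open>The terms \<open>i = 0\<close> and \<open>i = 1\<close> are split off, with
    coefficients \<open>fib 1 = 1\<close> and \<open>fib 3 = 2\<close>, so that the remaining sum
    again runs over \<open>i \<le> n\<close>.\<close>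
  have "s (n + 2) = c (n + 2) + 2 * c (n + 1) + (\<Sum>i\<le>n. int (fib (2 * i + 5)) * c (n - i))"
    unfolding s_def
    by (simp add: sum.atMost_Suc_shift numeral_eq_Suc del: sum.atMost_Suc fib.simps(3))
       (simp add: numeral_eq_Suc)
  also have "(\<Sum>i\<le>n. int (fib (2 * i + 5)) * c (n - i)) =
      3 * (\<Sum>i\<le>n. int (fib (2 * i + 3)) * c (n - i)) - s n"
  proof -
    have "int (fib (2 * i + 5)) = 3 * int (fib (2 * i + 3)) - int (fib (2 * i + 1))" for i
      using fib_add_4[of "2 * i + 1"] by (simp add: numeral_eq_Suc)
    then show ?thesis
      unfolding s_def by (simp only: sum_distrib_left sum_subtractf left_diff_distrib mult.assoc)
  qed
  finally show ?thesis
    using s_Suc by simp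
qed

context
  fixes c :: "nat \<Rightarrow> int"
  defines "c n \<equiv> int (card (colored_compositions (\<lambda>k. fib (2 * k - 1)) n))"
begin

lemma odd_fib_compositions_Suc: "c (Suc n) = (\<Sum>i\<le>n. int (fib (2 * i + 1)) * c (n - i))"
  by (simp add: c_def card_colored_compositions_Suc)

lemma odd_fib_compositions_1: "c 1 = 1" and odd_fib_compositions_2: "c 2 = 3"
proof -
  have "c 0 = 1"
    by (simp add: c_def colored_compositions_0)
  then show "c 1 = 1"
    using odd_fib_compositions_Suc[of 0] by simp
  then show "c 2 = 3"
    using odd_fib_compositions_Suc[of 1] \<open>c 0 = 1\<close> by (simp add: numeral_eq_Suc)
qed

lemma odd_fib_compositions_rec:
  assumes "n \<ge> 3"
  shows "c n = 4 * c (n - 1) - 2 * c (n - 2)"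
proof -
  obtain k where k: "n = k + 3"
    using assms by (metis add.commute le_Suc_ex)
  \<comment> \<open>The convolution at \<open>m\<close> is \<open>c (Suc m)\<close> itself, so the
    terms \<open>c (k + 2)\<close> and \<open>c (k + 1)\<close> each occur twice and combine to the
    coefficients 4 and -2.\<close>
  have "c (Suc (k + 2)) = c (k + 2) - c (k + 1) + 3 * c (Suc (k + 1)) - c (Suc k)"
    unfolding odd_fib_compositions_Suc by (rule fib_convolution_add_2)
  then show ?thesis
    by (simp add: k numeral_eq_Suc)
qed

end

section \<open>Unimodal sequences\<close>

text \<open>Replaces the peak index by a cut with no condition across it: a larger one of the
  entries next to the cut is a peak.\<close>

lemma unimodal_iff:
  "unimodal xs \<longleftrightarrow> xs \<noteq> [] \<and> (\<exists>as bs. xs = as @ bs \<and> sorted as \<and> sorted (rev bs))"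
proof (intro iffI conjI; (elim conjE exE)?)
  assume "unimodal xs"
  then obtain t where t: "t < length xs" "\<And>i. i < t \<Longrightarrow> xs ! i \<le> xs ! Suc i"
    "\<And>i. t \<le> i \<Longrightarrow> Suc i < length xs \<Longrightarrow> xs ! Suc i \<le> xs ! i"
    by (auto simp: unimodal_def)
  show "xs \<noteq> []"
    using t by auto
  have "sorted (take t xs)" "sorted (rev (drop t xs))"
    using t unfolding sorted_rev_iff_nth_Suc by (auto simp: sorted_iff_nth_Suc)
  then show "\<exists>as bs. xs = as @ bs \<and> sorted as \<and> sorted (rev bs)"
    by (metis append_take_drop_id)
next
  fix as bs assume ne: "xs \<noteq> []" and xs: "xs = as @ bs" and s: "sorted as" "sorted (rev bs)"
  have up: "xs ! i \<le> xs ! Suc i" if "Suc i < length as" for i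
    using s that by (auto simp: xs nth_append sorted_iff_nth_Suc)
  have down: "xs ! Suc i \<le> xs ! i" if "length as \<le> i" "Suc i < length xs" for i
    using s that by (auto simp: xs nth_append sorted_rev_iff_nth_Suc Suc_diff_le)
  show "unimodal xs"
  \<comment> \<open>The peak is the last entry of \<open>as\<close>, at index
    \<open>length as - 1\<close>, unless \<open>as\<close> is empty or the first entry of
    \<open>bs\<close> is larger; then it is the latter, at index \<open>length as\<close>.\<close>
  proof (cases "as \<noteq> [] \<and> (length as < length xs \<longrightarrow> xs ! length as \<le> xs ! (length as - 1))")
    case True
    then have "\<forall>i. length as - 1 \<le> i \<and> Suc i < length xs \<longrightarrow> xs ! Suc i \<le> xs ! i"
      using down by (metis One_nat_def Suc_lessD Suc_pred le_neq_implies_less length_greater_0_conv less_Suc_eq_le Suc_leI not_less)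
    moreover have "length as - 1 < length xs"
      using True xs by (cases as) auto
    ultimately show ?thesis
      using up unfolding unimodal_def by (intro exI[of _ "length as - 1"]) auto
  next
    case False
    then have "length as < length xs"
      using ne xs by auto
    moreover have "\<forall>i < length as. xs ! i \<le> xs ! Suc i"
    proof (intro allI impI)
      fix i assume "i < length as"
      then consider "Suc i < length as" | "i = length as - 1" "as \<noteq> []"
        by fastforce
      then show "xs ! i \<le> xs ! Suc i"
        using up False by cases auto
    qed
    ultimately show ?thesis
      using down unfolding unimodal_def by auto
  qed
qed

lemma unimodal_rev: "unimodal (rev xs) \<longleftrightarrow> unimodal xs"
proof -
  have "unimodal (rev ys)" if "unimodal ys" for ys
    using that by (force simp: unimodal_iff)
  from this[of xs] this[of "rev xs"] show ?thesis by auto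
qed

lemma unimodal_map:
  assumes "\<And>x y. x \<in> set xs \<Longrightarrow> y \<in> set xs \<Longrightarrow> x \<le> y \<Longrightarrow> f x \<le> f y" "unimodal xs"
  shows "unimodal (map f xs)"
proof -
  obtain as bs where *: "xs = as @ bs" "sorted as" "sorted (rev bs)" and "xs \<noteq> []"
    using assms unimodal_iff by auto
  have "sorted (map f as)" "sorted (rev (map f bs))"
    using * assms(1) by (auto simp: rev_map sorted_map intro: sorted_wrt_mono_rel[rotated])
  then show ?thesis
    using * \<open>xs \<noteq> []\<close> unfolding unimodal_iff by auto
qed

lemma unimodal_singleton: "unimodal [a]"
  by (auto simp: unimodal_def)

text \<open>A lower bound put in front extends the increasing piece. The empty list is excluded
  because \<open>[a]\<close> is unimodal and \<open>[]\<close> is not.\<close>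

lemma unimodal_Cons:
  assumes "ys \<noteq> []" "\<forall>y \<in> set ys. a \<le> y"
  shows "unimodal (a # ys) \<longleftrightarrow> unimodal ys"
proof
  assume "unimodal (a # ys)"
  then obtain as bs where *: "a # ys = as @ bs" "sorted as" "sorted (rev bs)"
    by (auto simp: unimodal_iff)
  show "unimodal ys"
  proof (cases as)
    case Nil
    then have "sorted (rev ys)"
      using * by (auto simp: sorted_append)
    then show ?thesis
      using assms unfolding unimodal_iff by (metis append_Nil sorted_wrt.simps(1))
  next
    case (Cons _ as')
    then show ?thesis
      using * assms by (auto simp: unimodal_iff)
  qed
next
  assume "unimodal ys"
  then obtain as bs where *: "ys = as @ bs" "sorted as" "sorted (rev bs)"
    by (auto simp: unimodal_iff)
  then have "a # ys = (a # as) @ bs" "sorted (a # as)"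
    using assms by auto
  then show "unimodal (a # ys)"
    using * unfolding unimodal_iff by blast
qed

lemma unimodal_snoc:
  assumes "ys \<noteq> []" "\<forall>y \<in> set ys. a \<le> y"
  shows "unimodal (ys @ [a]) \<longleftrightarrow> unimodal ys"
  using unimodal_Cons[of "rev ys" a] assms unimodal_rev[of "ys @ [a]"] unimodal_rev[of ys] by simp

text \<open>An increasing piece is bounded below by its head, a decreasing one by its last
  entry.\<close>

lemma unimodal_min_at_end:
  assumes "unimodal xs" "x \<in> set xs"
  shows "hd xs \<le> x \<or> last xs \<le> x"
proof -
  obtain as bs where *: "xs = as @ bs" "sorted as" "sorted (rev bs)"
    using assms unimodal_iff by auto
  have "hd as \<le> x" if "x \<in> set as"
    using that * by (cases as) auto
  moreover have "last bs \<le> x" if "x \<in> set bs"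
    using that * by (cases bs rule: rev_cases) auto
  ultimately show ?thesis
    using * assms by (auto simp: hd_append last_append)
qed

section \<open>Covering unimodal sequences\<close>

lemma finite_unimodal_covering: "finite (unimodal_covering n)"
proof (rule finite_subset)
  show "unimodal_covering n \<subseteq> {xs. set xs \<subseteq> {1..n} \<and> length xs = n}"
  proof
    fix xs assume "xs \<in> unimodal_covering n"
    then obtain m where "set xs = {1..m}" "length xs = n"
      by (auto simp: unimodal_covering_def covers_initial_interval_def)
    moreover from this have "m \<le> n"
      by (metis card_atLeastAtMost card_length diff_Suc_1)
    ultimately show "xs \<in> {xs. set xs \<subseteq> {1..n} \<and> length xs = n}"
      by auto
  qed
qed (simp add: finite_lists_length_eq)

lemma mem_unimodal_covering_iff:
  "xs \<in> unimodal_covering n \<longleftrightarrow> length xs = n \<and> unimodal xs \<and> (\<exists>m. set xs = {1..m})"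
  unfolding unimodal_covering_def covers_initial_interval_def by auto

text \<open>Unimodal sequences are nonempty, which forces \<open>m \<ge> 1\<close>.\<close>

lemma one_mem_unimodal_covering:
  assumes "xs \<in> unimodal_covering n"
  shows "1 \<in> set xs"
proof -
  obtain m where "set xs = {1..m}" "xs \<noteq> []"
    using assms by (auto simp: mem_unimodal_covering_iff unimodal_iff)
  then show ?thesis
    by (cases m) auto
qed

text \<open>The possible remainders after deleting a 1 from an end of a covering sequence;
  \<open>insert\<close> allows further 1s to be present.\<close>

definition almost_covering :: "nat \<Rightarrow> nat list set" where
  "almost_covering n = {xs. length xs = n \<and> unimodal xs \<and> (\<exists>m. insert 1 (set xs) = {1..m})}"

lemma almost_covering_eq:
  "almost_covering n = unimodal_covering n \<union> map Suc ` unimodal_covering n"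
proof (intro set_eqI iffI)
  fix xs assume xs: "xs \<in> almost_covering n"
  then obtain m where m: "insert 1 (set xs) = {1..m}"
    by (auto simp: almost_covering_def)
  show "xs \<in> unimodal_covering n \<union> map Suc ` unimodal_covering n"
  proof (cases "1 \<in> set xs")
    case True
    then have "set xs = {1..m}"
      using m by (simp add: insert_absorb)
    then show ?thesis
      using xs by (auto simp: mem_unimodal_covering_iff almost_covering_def)
  next
    case False
    \<comment> \<open>Without a 1 all entries are at least 2, so the truncated subtraction is undone
      by \<open>Suc\<close>.\<close>
    let ?ys = "map (\<lambda>x. x - 1) xs"
    have "set xs = {1..m} - {1}"
      using m False by auto
    also have "\<dots> = Suc ` {1..m - 1}"
      by (auto simp: image_Suc_atLeastAtMost)
    finally have set_xs: "set xs = Suc ` {1..m - 1}" .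
    then have "set ?ys = {1..m - 1}"
      by (simp only: set_map image_image) simp
    moreover have "unimodal ?ys"
      using xs by (intro unimodal_map) (auto simp: almost_covering_def)
    ultimately have "?ys \<in> unimodal_covering n"
      using xs by (auto simp: mem_unimodal_covering_iff almost_covering_def)
    moreover have "map Suc ?ys = xs"
      using set_xs by (auto intro!: map_idI)
    ultimately show ?thesis
      by (metis UnI2 imageI)
  qed
next
  fix xs assume "xs \<in> unimodal_covering n \<union> map Suc ` unimodal_covering n"
  then consider "xs \<in> unimodal_covering n" | ys where "xs = map Suc ys" "ys \<in> unimodal_covering n"
    by auto
  then show "xs \<in> almost_covering n"
  proof cases
    case 1
    then have "insert 1 (set xs) = set xs"
      using one_mem_unimodal_covering by auto
    then show ?thesis
      using 1 by (auto simp: mem_unimodal_covering_iff almost_covering_def)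
  next
    case 2
    then obtain m where "set ys = {1..m}"
      by (auto simp: mem_unimodal_covering_iff)
    then have "insert 1 (set xs) = {1..Suc m}"
      by (auto simp: 2 image_iff Bex_def)
    then show ?thesis
      using 2 by (auto simp: mem_unimodal_covering_iff almost_covering_def intro!: unimodal_map)
  qed
qed

text \<open>The union is disjoint: a covering sequence contains 1, whereas raising positive entries
  by one leaves no 1.\<close>

lemma card_almost_covering: "card (almost_covering n) = 2 * card (unimodal_covering n)"
proof -
  have "map Suc xs \<notin> unimodal_covering n" if "xs \<in> unimodal_covering n" for xs
    using one_mem_unimodal_covering[of "map Suc xs" n] that
    by (auto simp: mem_unimodal_covering_iff unimodal_iff)
  then have "unimodal_covering n \<inter> map Suc ` unimodal_covering n = {}"
    by auto
  then show ?thesis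
    unfolding almost_covering_eq
    by (simp add: card_Un_disjoint finite_unimodal_covering card_image inj_on_def)
qed

lemma Cons_1_mem_unimodal_covering:
  assumes "n > 0"
  shows "1 # ys \<in> unimodal_covering (Suc n) \<longleftrightarrow> ys \<in> almost_covering n"
proof -
  have "unimodal (1 # ys) \<longleftrightarrow> unimodal ys" if "length ys = n" "insert 1 (set ys) = {1..m}" for m
    using that assms by (intro unimodal_Cons) auto
  then show ?thesis
    by (auto simp: mem_unimodal_covering_iff almost_covering_def)
qed

lemma snoc_1_mem_unimodal_covering:
  assumes "n > 0"
  shows "ys @ [1] \<in> unimodal_covering (Suc n) \<longleftrightarrow> ys \<in> almost_covering n"
proof -
  have "unimodal (ys @ [1]) \<longleftrightarrow> unimodal ys" if "length ys = n" "insert 1 (set ys) = {1..m}" for m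
    using that assms by (intro unimodal_snoc) auto
  then show ?thesis
    by (auto simp: mem_unimodal_covering_iff almost_covering_def)
qed

text \<open>For a list that already contains 1, almost covering and covering mean the same.\<close>

lemma Cons_1_mem_almost_covering:
  assumes "n > 0"
  shows "1 # ys \<in> almost_covering (Suc n) \<longleftrightarrow> ys \<in> almost_covering n"
  using Cons_1_mem_unimodal_covering[OF assms, of ys]
  by (auto simp: mem_unimodal_covering_iff almost_covering_def)

lemma unimodal_covering_Suc:
  assumes "n > 0"
  shows "unimodal_covering (Suc n) =
    (#) 1 ` almost_covering n \<union> (\<lambda>ys. ys @ [1]) ` almost_covering n"
proof (intro set_eqI iffI)
  fix xs assume xs: "xs \<in> unimodal_covering (Suc n)"
  then have "xs \<noteq> []" and pos: "\<forall>x \<in> set xs. 1 \<le> x"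
    by (auto simp: mem_unimodal_covering_iff unimodal_iff)
  \<comment> \<open>The minimum of \<open>xs\<close> is 1, and it occurs at an end.\<close>
  have "hd xs \<le> 1 \<or> last xs \<le> 1"
    using unimodal_min_at_end[of xs 1] xs one_mem_unimodal_covering[OF xs]
    by (auto simp: mem_unimodal_covering_iff)
  then have "hd xs = 1 \<or> last xs = 1"
    using pos \<open>xs \<noteq> []\<close> by (meson hd_in_set last_in_set le_antisym)
  then have "xs = 1 # tl xs \<or> xs = butlast xs @ [1]"
    using \<open>xs \<noteq> []\<close> by (metis append_butlast_last_id list.collapse)
  then show "xs \<in> (#) 1 ` almost_covering n \<union> (\<lambda>ys. ys @ [1]) ` almost_covering n"
    using xs Cons_1_mem_unimodal_covering[OF assms] snoc_1_mem_unimodal_covering[OF assms]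
    by (metis (no_types, lifting) UnI1 UnI2 imageI)
next
  fix xs assume "xs \<in> (#) 1 ` almost_covering n \<union> (\<lambda>ys. ys @ [1]) ` almost_covering n"
  then show "xs \<in> unimodal_covering (Suc n)"
    using Cons_1_mem_unimodal_covering[OF assms] snoc_1_mem_unimodal_covering[OF assms] by auto
qed

text \<open>Sequences with a 1 at both ends correspond to their middle part \<open>zs\<close>, which
  is nonempty as \<open>n > 0\<close>.\<close>

lemma almost_covering_Cons_Int_snoc:
  assumes "n > 0"
  shows "(#) 1 ` almost_covering (Suc n) \<inter> (\<lambda>ys. ys @ [1]) ` almost_covering (Suc n) =
    (\<lambda>zs. 1 # zs @ [1]) ` almost_covering n"
proof (intro set_eqI iffI)
  fix xs
  assume "xs \<in> (#) 1 ` almost_covering (Suc n) \<inter> (\<lambda>ys. ys @ [1]) ` almost_covering (Suc n)"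
  then obtain us ys where *: "xs = 1 # us" "xs = ys @ [1]" "ys \<in> almost_covering (Suc n)"
    by blast
  moreover from this have "ys \<noteq> []"
    by (auto simp: almost_covering_def)
  ultimately obtain zs where "ys = 1 # zs"
    by (cases ys) auto
  then show "xs \<in> (\<lambda>zs. 1 # zs @ [1]) ` almost_covering n"
    using * Cons_1_mem_almost_covering[OF assms] by auto
next
  fix xs assume "xs \<in> (\<lambda>zs. 1 # zs @ [1]) ` almost_covering n"
  then obtain zs where zs: "xs = 1 # zs @ [1]" "zs \<in> almost_covering n"
    by auto
  then have ys: "1 # zs \<in> almost_covering (Suc n)"
    using Cons_1_mem_almost_covering[OF assms] by simp
  \<comment> \<open>Membership passes through the full sequence: the final 1 is appended to
    \<open>1 # zs\<close>, then the initial 1 is removed.\<close>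
  then have "xs \<in> unimodal_covering (Suc (Suc n))"
    using snoc_1_mem_unimodal_covering[of "Suc n" "1 # zs"] zs by simp
  then have "zs @ [1] \<in> almost_covering (Suc n)"
    using Cons_1_mem_unimodal_covering[of "Suc n" "zs @ [1]"] zs by simp
  then show "xs \<in> (#) 1 ` almost_covering (Suc n) \<inter> (\<lambda>ys. ys @ [1]) ` almost_covering (Suc n)"
    using ys zs by (auto intro: rev_image_eqI)
qed

text \<open>Inclusion-exclusion over the two ends, each contributing
  \<open>2 * card (unimodal_covering n)\<close>; the additive form avoids subtraction of natural
  numbers.\<close>

lemma card_unimodal_covering_Suc:
  assumes "n > 0"
  shows "card (unimodal_covering (Suc n)) +
      card ((#) 1 ` almost_covering n \<inter> (\<lambda>ys. ys @ [1]) ` almost_covering n) =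
    4 * card (unimodal_covering n)"
proof -
  have "finite (almost_covering n)"
    by (simp add: almost_covering_eq finite_unimodal_covering)
  then show ?thesis
    unfolding unimodal_covering_Suc[OF assms]
    by (subst card_Un_Int[symmetric]) (auto simp: card_image inj_on_def card_almost_covering)
qed

lemma card_unimodal_covering_1: "card (unimodal_covering 1) = 1"
proof -
  have "unimodal_covering 1 = {[1]}"
  proof (intro set_eqI iffI)
    fix xs assume "xs \<in> unimodal_covering 1"
    then show "xs \<in> {[1]}"
      using one_mem_unimodal_covering[of xs 1]
      by (auto simp: mem_unimodal_covering_iff length_Suc_conv)
  next
    fix xs :: "nat list" assume "xs \<in> {[1]}"
    then show "xs \<in> unimodal_covering 1"
      by (auto simp: mem_unimodal_covering_iff unimodal_singleton intro!: exI[of _ 1])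
  qed
  then show ?thesis by simp
qed

text \<open>Here the middle part is empty, so the overlap is computed directly: it is only
  \<open>[1, 1]\<close>, giving 4 - 1 = 3.\<close>

lemma card_unimodal_covering_2: "card (unimodal_covering 2) = 3"
proof -
  have "xs \<in> {[1, 1]}" if "xs \<in> (#) 1 ` almost_covering 1 \<inter> (\<lambda>ys. ys @ [1]) ` almost_covering 1" for xs
    using that by (auto simp: almost_covering_def length_Suc_conv)
  moreover have "[1] \<in> almost_covering 1"
    by (auto simp: almost_covering_def unimodal_singleton intro!: exI[of _ 1])
  ultimately have "(#) 1 ` almost_covering 1 \<inter> (\<lambda>ys. ys @ [1]) ` almost_covering 1 = {[1, 1]}"
    by (auto intro: rev_image_eqI)
  then show ?thesis
    using card_unimodal_covering_Suc[of 1] card_unimodal_covering_1 by (simp add: numeral_2_eq_2)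
qed

lemma card_unimodal_covering_rec:
  assumes "n \<ge> 3"
  shows "card (unimodal_covering n) + 2 * card (unimodal_covering (n - 2)) =
    4 * card (unimodal_covering (n - 1))"
proof -
  obtain k where k: "n = Suc (Suc k)" "k > 0"
    using assms by (metis One_nat_def Suc_le_D Suc_le_mono numeral_3_eq_3 zero_less_Suc)
  have "card ((\<lambda>zs. 1 # zs @ [1]) ` almost_covering k) = 2 * card (unimodal_covering k)"
    by (simp add: card_image inj_on_def card_almost_covering)
  then show ?thesis
    using card_unimodal_covering_Suc[of "Suc k"] k
    by (simp only: almost_covering_Cons_Int_snoc) simp
qed

section \<open>Equality of the cardinalities\<close>

lemma card_odd_fib_compositions_eq:
  assumes "n \<ge> 1"
  shows "card (colored_compositions (\<lambda>k. fib (2 * k - 1)) n) = card (unimodal_covering n)"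
  using assms
proof (induction n rule: less_induct)
  case (less n)
  consider "n = 1" | "n = 2" | "n \<ge> 3"
    using less.prems by linarith
  then show ?case
  proof cases
    case 1
    then show ?thesis
      using odd_fib_compositions_1 card_unimodal_covering_1 by simp
  next
    case 2
    then show ?thesis
      using odd_fib_compositions_2 card_unimodal_covering_2 by simp
  next
    case 3
    then show ?thesis
      using odd_fib_compositions_rec[OF 3] card_unimodal_covering_rec[OF 3]
        less.IH[of "n - 1"] less.IH[of "n - 2"] by simp
  qed
qed

theorem theorem5p5:
  fixes b :: "nat \<Rightarrow> int"
  assumes "\<And>n. n \<ge> 1 \<Longrightarrow> b n = int (card (colored_compositions (\<lambda>k. fib (2 * k - 1)) n))"
  shows "(\<forall>n \<ge> 1.
            finite (colored_compositions (\<lambda>k. fib (2 * k - 1)) n) \<and>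
            finite (unimodal_covering n) \<and>
            (\<exists>f. bij_betw f (colored_compositions (\<lambda>k. fib (2 * k - 1)) n) (unimodal_covering n)) \<and>
            b n = int (card (unimodal_covering n))) \<and>
         b 1 = 1 \<and> b 2 = 3 \<and> (\<forall>n \<ge> 3. b n = 4 * b (n - 1) - 2 * b (n - 2)) \<and>
         map b [1..<9] = [1, 3, 10, 34, 116, 396, 1352, 4616]"
proof -
  \<comment> \<open>No explicit bijection is constructed; \<open>f\<close> comes from finiteness and
    equal cardinalities.\<close>
  have bij: "\<forall>n \<ge> 1.
      finite (colored_compositions (\<lambda>k. fib (2 * k - 1)) n) \<and>
      finite (unimodal_covering n) \<and>
      (\<exists>f. bij_betw f (colored_compositions (\<lambda>k. fib (2 * k - 1)) n) (unimodal_covering n)) \<and>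
      b n = int (card (unimodal_covering n))"
    using assms card_odd_fib_compositions_eq
    by (simp add: finite_colored_compositions finite_unimodal_covering finite_same_card_bij)
  have b1: "b 1 = 1" and b2: "b 2 = 3"
    using assms[of 1] assms[of 2] odd_fib_compositions_1 odd_fib_compositions_2 by simp_all
  have rec: "b n = 4 * b (n - 1) - 2 * b (n - 2)" if "n \<ge> 3" for n
    using odd_fib_compositions_rec[OF that] assms[of n] assms[of "n - 1"] assms[of "n - 2"] that
    by simp
  have "[1..<9] = [1, 2, 3, 4, 5, 6, 7, 8::nat]"
    by (simp add: upt_rec)
  then have "map b [1..<9] = [1, 3, 10, 34, 116, 396, 1352, 4616]"
    using b1 b2 rec[of 3] rec[of 4] rec[of 5] rec[of 6] rec[of 7] rec[of 8] by simp
  with bij b1 b2 rec show ?thesis by blast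
qed

end
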